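(* The branch and bound algorithm for the traveling salesman problem (the Little–Murty–Sweeney–Karel algorithm, in the form given in the context) is not an algorithm of "direct type" (in the sense of conditions ( * ) and ( ** ) of the context): condition ( * ) fails for it. Explicitly, there exist $n$, a root-to-leaf chain $B_1d_1B_2d_2\ldots B_kd_k\,\bm x$ of its linear separating tree $\mathcal T_n$, and a solution $\bm y\in X$ adjacent to $\bm x$, such that for every $i\in[k]$ there exists an input $C$ with $\langle B_i,C\rangle\,\mathrm{sgn}\,d_i>0$ and $C\in K(\bm y)$.
   Context: **Problem.** Let $n\ge 3$, $V=[n]=\{1,\dots,n\}$, $A=\{(i,j): i,j\in V,\ i\ne j\}$. An input is a matrix $C=(c_{ij})$ with $c_{ij}\in\mathbb Z$ for $i\neq j$ and $c_{ii}=\infty$. For $H\subseteq A$ let $\mathrm{len}(H)=\sum_{(i,j)\in H}c_{ij}$. The task is to find a Hamiltonian circuit (directed Hamiltonian cycle) $H\subseteq A$ of minimum length. $X$ is the set of 0/1 characteristic vectors $\bm x=(x_{ij})$ of Hamiltonian circuits of $(V,A)$ and $\langle \bm x,C\rangle=\sum_{i\ne j}x_{ij}c_{ij}$. A solution $\bm x\in X$ is optimal for $C$ if $\langle \bm x,C\rangle\le\langle \bm y,C\rangle$ for all $\bm y\in X$. Distinct $\bm x,\bm y\in X$ are adjacent if there is an input $C$ for which $\bm x$ and $\bm y$, and no other elements of $X$, are optimal. For $\bm x\in X$, $K(\bm x)=\{C:\langle \bm x,C\rangle\le\langle \bm y,C\rangle\ \forall \bm y\in X\}$ is the cone of inputs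 for which $\bm x$ is optimal. **Algorithm.** $I(M)$, $J(M)$ denote the sets of row and column indices of a matrix $M$; $M(S,T)$ is the submatrix with rows $S$ and columns $T$. Loops run over indices in increasing order. Conventions: $\infty\pm b=\infty$ for integers $b$, $\infty+\infty=\infty-\infty=\infty$, $\infty>b$ for integers $b$, and $\infty>\infty$ is false. Global variables: $H_{opt}$ and $l_{opt}$, initially $l_{opt}=\infty$. The algorithm calls BranchBound$(C,\emptyset,0)$ and outputs the final $H_{opt}$ (as its characteristic vector). BranchBound$(M,Arcs,sum)$ (arguments passed by value): 1. Perform Reduction$(M,sum)$ (which modifies $M$ and $sum$). 2. If $sum\ge l_{opt}$, return. 3. $(i,j):=$ ChooseArc$(M)$. 4. If $|I(M)|=3$: let $H$ be the unique Hamiltonian circuit containing $Arcs\cup\{(i,j)\}$; if $\mathrm{len}(H)<l_{opt}$, set $H_{opt}:=H$, $l_{opt}:=\mathrm{len}(H)$. Otherwise: $M':=M(I(M)\setminus\{i\},J(M)\setminus\{j\})$; let $l$ and $k$ be the end and the beginning, respectively, of the inclusion-maximal path in $Arcs\cup\{(i,j)\}$ containing $(i,j)$; set $M'[l,k]:=\infty$; call BranchBound$(M',Arcs\cup\{(i,j)\},sum)$. 5. Set $M[i,j]:=\infty$ and call BranchBound$(M,Arcs,sum)$. Reduction$(M,sum)$: for each $i\in I(M)$: $m:=\infty$; for each $j\in J(M)$, if $m>M[i,j]$ then $m:=M[i,j]$; then $sum:=sum+m$ and $M[i,j]:=M[i,j]-m$ for all $j\in J(M)$. Then for each $j\in J(M)$: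 $m:=\infty$; for each $i\in I(M)$, if $m>M[i,j]$ then $m:=M[i,j]$; then $sum:=sum+m$ and $M[i,j]:=M[i,j]-m$ for all $i\in I(M)$. ChooseArc$(M)$: $w:=-1$. For each $i\in I(M)$, for each $j\in J(M)$: if $M[i,j]=0$, then: $m:=\infty$; for each $t\in J(M)\setminus\{j\}$, if $m>M[i,t]$ then $m:=M[i,t]$; $k:=\infty$; for each $t\in I(M)\setminus\{i\}$, if $k>M[t,j]$ then $k:=M[t,j]$; if $m+k>w$ then $w:=m+k$, $(i^*,j^* ):=(i,j)$. Return $(i^*,j^* )$. **The tree $\mathcal T_n$.** Every finite value handled by the algorithm (except the initial $w=-1$) is, for a given history of test outcomes, an integer linear form in the off-diagonal entries of $C$. Each test thus compares a linear form $\langle B,C\rangle$ with $0$: its outcome is $\langle B,C\rangle>0$ or $\langle B,C\rangle\le 0$ (for strict comparisons), or $\langle B,C\rangle\ge0$ or $\langle B,C\rangle<0$ (for non-strict ones). The test $M[i,j]=0$ is applied only to nonnegative entries and is regarded as the test $M[i,j]>0$. Tests involving $\infty$, the initial value $w=-1$, or two formally identical linear forms carry no information and are not counted. The internal nodes of $\mathcal T_n$ are the counted tests performed by the algorithm (each node being identified with its coefficient vector $B$ in the notation for chains), two runs (on two inputs) being at the same node if and only if all their preceding counted tests had the same outcomes; only nodes reached by at least one input $C$ are considered. From each node leave an edge $d$ with $\mathrm{sgn}\,d=+1$ (the outcome $\langle B,C\rangle>0$ or $\ge 0$) and an edge with $\mathrm{sgn}\,d=-1$ (the opposite outcome). Leaves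 correspond to terminated runs and are labelled by the output $\bm x\in X$. A root-to-leaf chain is written $B_1d_1B_2d_2\ldots B_kd_k\,\bm x$, where $d_i$ is the edge followed out of node $B_i$ and $\bm x$ is the label of the leaf; such a chain is the run of the algorithm on some input. **"Direct type".** The tree is of "direct type" (in quotation marks) if every root-to-leaf chain $B_1d_1\ldots B_kd_k\,\bm x$ satisfies: ( * ) for every $\bm y\in X$ adjacent to $\bm x$ there is $i\in[k]$ such that the conditions $\langle B_i,C\rangle\,\mathrm{sgn}\,d_i>0$ and $C\in K(\bm y)$ are incompatible (no input $C$ satisfies both); ( ** ) for every $i\in[k]$: if $\langle B_i,C\rangle\,\mathrm{sgn}\,d_i>0$ and $C\in K(\bm y)$ are incompatible for some $\bm y$ adjacent to $\bm x$, and the cone $K(\bm x)\cap\{C:\langle B_i,C\rangle\,\mathrm{sgn}\,d_i\le0\}$ is full-dimensional, then the branch starting at node $B_i$ with the other edge $-d_i$ has at least one leaf labelled $\bm x$. The algorithm is of "direct type" if $\mathcal T_n$ is of "direct type" for every $n\ge3$. *)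

theory Defs
  imports Complex_Main "HOL-Library.Function_Algebras"
begin

section \<open>The traveling salesman problem\<close>

type_synonym vec = "nat \<times> nat \<Rightarrow> int"

definition arcs :: "nat \<Rightarrow> (nat \<times> nat) set" where
  "arcs n = {(i, j). i \<in> {1..n} \<and> j \<in> {1..n} \<and> i \<noteq> j}"

text \<open>An input is given by its off-diagonal entries, extended by \<open>0\<close>; the diagonal entries
  \<open>\<infinity>\<close> are put in by the algorithm (see \<open>init_matrix\<close>).\<close>

definition inputs :: "nat \<Rightarrow> vec set" where
  "inputs n = {C. \<forall>a. a \<notin> arcs n \<longrightarrow> C a = 0}"

definition inner_prod :: "nat \<Rightarrow> vec \<Rightarrow> vec \<Rightarrow> int" where
  "inner_prod n B C = (\<Sum>a\<in>arcs n. B a * C a)"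

definition char_vec :: "(nat \<times> nat) set \<Rightarrow> vec" where
  "char_vec H = (\<lambda>a. if a \<in> H then 1 else 0)"

text \<open>The list \<open>p\<close> visits every vertex once, and \<open>H\<close> joins cyclically consecutive entries.\<close>

definition ham_circuit :: "nat \<Rightarrow> (nat \<times> nat) set \<Rightarrow> bool" where
  "ham_circuit n H \<longleftrightarrow>
     (\<exists>p. distinct p \<and> set p = {1..n} \<and> H = set (zip p (rotate1 p)) \<and> H \<subseteq> arcs n)"

definition solutions :: "nat \<Rightarrow> vec set" where
  "solutions n = {char_vec H | H. ham_circuit n H}"

definition optimal :: "nat \<Rightarrow> vec \<Rightarrow> vec \<Rightarrow> bool" where
  "optimal n x C \<longleftrightarrow>
     x \<in> solutions n \<and> (\<forall>y\<in>solutions n. inner_prod n x C \<le> inner_prod n y C)"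

definition adjacent :: "nat \<Rightarrow> vec \<Rightarrow> vec \<Rightarrow> bool" where
  "adjacent n x y \<longleftrightarrow> x \<in> solutions n \<and> y \<in> solutions n \<and> x \<noteq> y \<and>
     (\<exists>C\<in>inputs n. {z. optimal n z C} = {x, y})"

definition K :: "nat \<Rightarrow> vec \<Rightarrow> vec set" where
  "K n x = {C \<in> inputs n. \<forall>y\<in>solutions n. inner_prod n x C \<le> inner_prod n y C}"


section \<open>Symbolic values and tests\<close>

text \<open>A value handled by the algorithm is \<open>\<infinity>\<close> or a linear form in the entries of the input,
  stored as its coefficient vector. The difference of a finite value and \<open>\<infinity>\<close> never occurs.\<close>

datatype val = Fin vec | Infty

fun add :: "val \<Rightarrow> val \<Rightarrow> val" where
  "add (Fin a) (Fin b) = Fin (a + b)"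
| "add _ _ = Infty"

fun sub :: "val \<Rightarrow> val \<Rightarrow> val" where
  "sub (Fin a) (Fin b) = Fin (a - b)"
| "sub _ _ = Infty"

text \<open>A record \<open>(B, d)\<close> of a counted test: its coefficient vector and the sign (\<open>1\<close> or \<open>-1\<close>) of
  its outcome. Every procedure below returns the list of the counted tests it performed on the
  input \<open>C\<close>, in order, followed by its result.\<close>

type_synonym test = "vec \<times> int"

definition strict_test :: "nat \<Rightarrow> vec \<Rightarrow> vec \<Rightarrow> test list \<times> bool" where
  "strict_test n C B =
     (if inner_prod n B C > 0 then ([(B, 1)], True) else ([(B, -1)], False))"

definition nonstrict_test :: "nat \<Rightarrow> vec \<Rightarrow> vec \<Rightarrow> test list \<times> bool" where
  "nonstrict_test n C B =
     (if inner_prod n B C \<ge> 0 then ([(B, 1)], True) else ([(B, -1)], False))"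

text \<open>The comparison \<open>u > v\<close>.\<close>

fun gt_test :: "nat \<Rightarrow> vec \<Rightarrow> val \<Rightarrow> val \<Rightarrow> test list \<times> bool" where
  "gt_test n C (Fin a) (Fin b) = (if a = b then ([], False) else strict_test n C (a - b))"
| "gt_test n C Infty (Fin b) = ([], True)"
| "gt_test n C _ Infty = ([], False)"

text \<open>The comparison \<open>u \<ge> v\<close>.\<close>

fun ge_test :: "nat \<Rightarrow> vec \<Rightarrow> val \<Rightarrow> val \<Rightarrow> test list \<times> bool" where
  "ge_test n C (Fin a) (Fin b) = (if a = b then ([], True) else nonstrict_test n C (a - b))"
| "ge_test n C Infty _ = ([], True)"
| "ge_test n C (Fin a) Infty = ([], False)"

text \<open>The test \<open>u = 0\<close>, which is performed as \<open>u > 0\<close> and succeeds if the latter fails.\<close>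

fun zero_test :: "nat \<Rightarrow> vec \<Rightarrow> val \<Rightarrow> test list \<times> bool" where
  "zero_test n C (Fin a) =
     (if a = 0 then ([], True) else let (ts, b) = strict_test n C a in (ts, \<not> b))"
| "zero_test n C Infty = ([], False)"

text \<open>The comparison \<open>u > w\<close> in the choice of an arc, where \<open>None\<close> is the initial value \<open>w = -1\<close>;
  \<open>u\<close> is always nonnegative there.\<close>

fun weight_test :: "nat \<Rightarrow> vec \<Rightarrow> val \<Rightarrow> val option \<Rightarrow> test list \<times> bool" where
  "weight_test n C u None = ([], True)"
| "weight_test n C u (Some w) = gt_test n C u w"


section \<open>The algorithm\<close>

text \<open>The index sets of a matrix are increasing lists \<open>I\<close> (rows) and \<open>J\<close> (columns); entries
  outside \<open>I \<times> J\<close> are meaningless.\<close>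

type_synonym matrix = "nat \<Rightarrow> nat \<Rightarrow> val"

definition upd :: "matrix \<Rightarrow> nat \<Rightarrow> nat \<Rightarrow> val \<Rightarrow> matrix" where
  "upd M i j v = M(i := (M i)(j := v))"

text \<open>The loop ``if \<open>m > v\<close> then \<open>m := v\<close>''.\<close>

fun scan_min :: "nat \<Rightarrow> vec \<Rightarrow> val \<Rightarrow> val list \<Rightarrow> test list \<times> val" where
  "scan_min n C m [] = ([], m)"
| "scan_min n C m (v # vs) =
     (let (t1, b) = gt_test n C m v;
          (t2, r) = scan_min n C (if b then v else m) vs
      in (t1 @ t2, r))"

fun reduce_rows ::
  "nat \<Rightarrow> vec \<Rightarrow> nat list \<Rightarrow> nat list \<Rightarrow> matrix \<Rightarrow> val \<Rightarrow> test list \<times> matrix \<times> val" where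
  "reduce_rows n C [] J M s = ([], M, s)"
| "reduce_rows n C (i # I) J M s =
     (let (t1, m) = scan_min n C Infty (map (\<lambda>j. M i j) J);
          M' = (\<lambda>i' j. if i' = i \<and> j \<in> set J then sub (M i' j) m else M i' j);
          (t2, r) = reduce_rows n C I J M' (add s m)
      in (t1 @ t2, r))"

fun reduce_cols ::
  "nat \<Rightarrow> vec \<Rightarrow> nat list \<Rightarrow> nat list \<Rightarrow> matrix \<Rightarrow> val \<Rightarrow> test list \<times> matrix \<times> val" where
  "reduce_cols n C I [] M s = ([], M, s)"
| "reduce_cols n C I (j # J) M s =
     (let (t1, m) = scan_min n C Infty (map (\<lambda>i. M i j) I);
          M' = (\<lambda>i j'. if j' = j \<and> i \<in> set I then sub (M i j') m else M i j');
          (t2, r) = reduce_cols n C I J M' (add s m)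
      in (t1 @ t2, r))"

definition reduction ::
  "nat \<Rightarrow> vec \<Rightarrow> nat list \<Rightarrow> nat list \<Rightarrow> matrix \<Rightarrow> val \<Rightarrow> test list \<times> matrix \<times> val" where
  "reduction n C I J M s =
     (let (t1, M1, s1) = reduce_rows n C I J M s;
          (t2, M2, s2) = reduce_cols n C I J M1 s1
      in (t1 @ t2, M2, s2))"

fun choose_loop ::
  "nat \<Rightarrow> vec \<Rightarrow> nat list \<Rightarrow> nat list \<Rightarrow> matrix \<Rightarrow> (nat \<times> nat) list \<Rightarrow> val option
    \<Rightarrow> (nat \<times> nat) option \<Rightarrow> test list \<times> (nat \<times> nat) option" where
  "choose_loop n C I J M [] w best = ([], best)"
| "choose_loop n C I J M ((i, j) # ps) w best =
     (let (t0, z) = zero_test n C (M i j) in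
      if z then
        let (t1, m) = scan_min n C Infty (map (\<lambda>t. M i t) (removeAll j J));
            (t2, k) = scan_min n C Infty (map (\<lambda>t. M t j) (removeAll i I));
            (t3, b) = weight_test n C (add m k) w;
            (t4, r) = (if b then choose_loop n C I J M ps (Some (add m k)) (Some (i, j))
                       else choose_loop n C I J M ps w best)
        in (t0 @ t1 @ t2 @ t3 @ t4, r)
      else
        let (t4, r) = choose_loop n C I J M ps w best in (t0 @ t4, r))"

definition choose_arc ::
  "nat \<Rightarrow> vec \<Rightarrow> nat list \<Rightarrow> nat list \<Rightarrow> matrix \<Rightarrow> test list \<times> (nat \<times> nat) option" where
  "choose_arc n C I J M = choose_loop n C I J M (List.product I J) None None"

text \<open>Directed paths, as lists of vertices, and the inclusion-maximal one containing the arc \<open>a\<close>.\<close>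

definition path_arcs :: "nat list \<Rightarrow> (nat \<times> nat) set" where
  "path_arcs p = set (zip p (tl p))"

definition is_path :: "(nat \<times> nat) set \<Rightarrow> nat list \<Rightarrow> bool" where
  "is_path E p \<longleftrightarrow> p \<noteq> [] \<and> distinct p \<and> path_arcs p \<subseteq> E"

definition max_path :: "(nat \<times> nat) set \<Rightarrow> nat \<times> nat \<Rightarrow> nat list" where
  "max_path E a = (THE p. is_path E p \<and> a \<in> path_arcs p \<and>
     (\<forall>q. is_path E q \<and> path_arcs p \<subseteq> path_arcs q \<longrightarrow> path_arcs q = path_arcs p))"

definition circuit_containing :: "nat \<Rightarrow> (nat \<times> nat) set \<Rightarrow> (nat \<times> nat) set" where
  "circuit_containing n E = (THE H. ham_circuit n H \<and> E \<subseteq> H)"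

text \<open>Facts for the termination of the recursion: each call deletes a row, or keeps the rows and
  turns a finite entry into \<open>\<infinity>\<close>.\<close>

definition fin_entries :: "nat list \<Rightarrow> nat list \<Rightarrow> matrix \<Rightarrow> (nat \<times> nat) set" where
  "fin_entries I J M = {(i, j). i \<in> set I \<and> j \<in> set J \<and> M i j \<noteq> Infty}"

lemma finite_fin_entries: "finite (fin_entries I J M)"
  by (rule finite_subset[of _ "set I \<times> set J"]) (auto simp: fin_entries_def)

lemma sub_Infty [simp]: "sub Infty v = Infty"
  by simp

lemma reduce_rows_Infty:
  "reduce_rows n C I J M s = (t, M', s') \<Longrightarrow> M i j = Infty \<Longrightarrow> M' i j = Infty"
proof (induction I arbitrary: M s t)
  case (Cons k ks)
  then show ?case by (force simp: Let_def split: prod.splits elim!: Cons.IH)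
qed simp

lemma reduce_cols_Infty:
  "reduce_cols n C I J M s = (t, M', s') \<Longrightarrow> M i j = Infty \<Longrightarrow> M' i j = Infty"
proof (induction J arbitrary: M s t)
  case (Cons k ks)
  then show ?case by (force simp: Let_def split: prod.splits elim!: Cons.IH)
qed simp

lemma reduction_Infty:
  "reduction n C I J M s = (t, M', s') \<Longrightarrow> M i j = Infty \<Longrightarrow> M' i j = Infty"
  by (auto simp: reduction_def split: prod.splits dest: reduce_rows_Infty reduce_cols_Infty)

lemma choose_loop_Some:
  "choose_loop n C I J M ps w best = (t, Some (i, j)) \<Longrightarrow>
     best = Some (i, j) \<or> (i, j) \<in> set ps \<and> M i j \<noteq> Infty"
  by (induction ps arbitrary: w best t) (force simp: Let_def split: prod.splits if_splits)+

lemma choose_arc_Some: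
  assumes "choose_arc n C I J M = (t, Some (i, j))"
  shows "i \<in> set I" "j \<in> set J" "M i j \<noteq> Infty"
  using choose_loop_Some[OF assms[unfolded choose_arc_def]] by auto

lemma length_less:
  assumes "(t, Some (i, j)) = choose_arc n C I J M"
  shows "length (removeAll i I) < length I"
  using choose_arc_Some(1)[OF assms[symmetric]] by (rule length_removeAll_less)

lemma card_fin_entries_less:
  assumes "(t, M1, s1) = reduction n C I J M s" "(t', Some (i, j)) = choose_arc n C I J M1"
  shows "card (fin_entries I J (upd M1 i j Infty)) < card (fin_entries I J M)"
proof (rule psubset_card_mono[OF finite_fin_entries])
  have "fin_entries I J (upd M1 i j Infty) \<subseteq> fin_entries I J M"
    using reduction_Infty[OF assms(1)[symmetric]]
    by (auto simp: fin_entries_def upd_def split: if_splits)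
  moreover have "(i, j) \<in> fin_entries I J M"
    using choose_arc_Some[OF assms(2)[symmetric]] reduction_Infty[OF assms(1)[symmetric]]
    by (auto simp: fin_entries_def)
  moreover have "(i, j) \<notin> fin_entries I J (upd M1 i j Infty)"
    by (simp add: fin_entries_def upd_def)
  ultimately show "fin_entries I J (upd M1 i j Infty) \<subset> fin_entries I J M" by blast
qed

text \<open>\<open>Hopt\<close> and \<open>lopt\<close> are the global variables, passed in and returned. When the choice of an arc
  is reached, \<open>s1\<close> is finite, so the reduced matrix has a zero entry and the case \<open>None\<close> does not
  occur.\<close>

function branch_bound ::
  "nat \<Rightarrow> vec \<Rightarrow> nat list \<Rightarrow> nat list \<Rightarrow> matrix \<Rightarrow> (nat \<times> nat) set \<Rightarrow> val
    \<Rightarrow> (nat \<times> nat) set \<Rightarrow> val \<Rightarrow> test list \<times> (nat \<times> nat) set \<times> val" where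
  "branch_bound n C I J M Arcs s Hopt lopt =
     (let (t1, M1, s1) = reduction n C I J M s;
          (t2, stop) = ge_test n C s1 lopt in
      if stop then (t1 @ t2, Hopt, lopt)
      else
        let (t3, best) = choose_arc n C I J M1 in
        case best of
          None \<Rightarrow> (t1 @ t2 @ t3, Hopt, lopt)
        | Some (i, j) \<Rightarrow>
            let Arcs1 = insert (i, j) Arcs;
                (t4, Hopt1, lopt1) =
                  (if length I = 3 then
                     let H = circuit_containing n Arcs1;
                         (t, less) = gt_test n C lopt (Fin (char_vec H))
                     in if less then (t, H, Fin (char_vec H)) else (t, Hopt, lopt)
                   else
                     let p = max_path Arcs1 (i, j); l = last p; k = hd p
                     in branch_bound n C (removeAll i I) (removeAll j J)
                          (upd M1 l k Infty) Arcs1 s1 Hopt lopt);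
                (t5, Hopt2, lopt2) = branch_bound n C I J (upd M1 i j Infty) Arcs s1 Hopt1 lopt1
            in (t1 @ t2 @ t3 @ t4 @ t5, Hopt2, lopt2))"
  by pat_completeness auto
termination
  by (relation "measures
        [\<lambda>(n, C, I, J, M, _). length I, \<lambda>(n, C, I, J, M, _). card (fin_entries I J M)]")
     (simp, (simp only: in_measures prod.case, blast intro: length_less card_fin_entries_less)+)

declare branch_bound.simps [simp del]

definition init_matrix :: matrix where
  "init_matrix i j = (if i = j then Infty else Fin (char_vec {(i, j)}))"

text \<open>The counted tests performed on the input \<open>C\<close>, and the output.\<close>

definition run :: "nat \<Rightarrow> vec \<Rightarrow> test list \<times> vec" where
  "run n C =
     (case branch_bound n C [1..<n+1] [1..<n+1] init_matrix {} (Fin 0) {} Infty of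
        (ts, Hopt, _) \<Rightarrow> (ts, char_vec Hopt))"


section \<open>The linear separating tree and ``direct type''\<close>

text \<open>A tree is given by its root-to-leaf chains: \<open>B\<^sub>1 d\<^sub>1 \<dots> B\<^sub>k d\<^sub>k x\<close> is the pair
  \<open>([(B\<^sub>1, sgn d\<^sub>1), \<dots>, (B\<^sub>k, sgn d\<^sub>k)], x)\<close>. A node is determined by the outcomes that lead to it.\<close>

type_synonym chain = "test list \<times> vec"

definition sep_tree :: "nat \<Rightarrow> chain set" where
  "sep_tree n = run n ` inputs n"

definition branch_leaves :: "chain set \<Rightarrow> int list \<Rightarrow> vec set" where
  "branch_leaves T ds = {x. \<exists>ts. (ts, x) \<in> T \<and> take (length ds) (map snd ts) = ds}"

definition incompatible :: "nat \<Rightarrow> test \<Rightarrow> vec \<Rightarrow> bool" where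
  "incompatible n bd y \<longleftrightarrow> \<not> (\<exists>C\<in>inputs n. inner_prod n (fst bd) C * snd bd > 0 \<and> C \<in> K n y)"

text \<open>For a cone of integer matrices; its dimension is that of its real linear span.\<close>

definition full_dimensional :: "nat \<Rightarrow> vec set \<Rightarrow> bool" where
  "full_dimensional n S \<longleftrightarrow>
     vector_space.dim (\<lambda>(r::real) (v :: nat \<times> nat \<Rightarrow> real) a. r * v a)
       ((\<lambda>C a. real_of_int (C a)) ` S) = card (arcs n)"

definition cond_star :: "nat \<Rightarrow> chain \<Rightarrow> bool" where
  "cond_star n = (\<lambda>(ts, x). \<forall>y\<in>solutions n. adjacent n x y \<longrightarrow>
     (\<exists>i<length ts. incompatible n (ts ! i) y))"

definition cond_star_star :: "nat \<Rightarrow> chain set \<Rightarrow> chain \<Rightarrow> bool" where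
  "cond_star_star n T = (\<lambda>(ts, x). \<forall>i<length ts.
     (\<exists>y. adjacent n x y \<and> incompatible n (ts ! i) y) \<and>
     full_dimensional n
       (K n x \<inter> {C \<in> inputs n. inner_prod n (fst (ts ! i)) C * snd (ts ! i) \<le> 0}) \<longrightarrow>
     x \<in> branch_leaves T (map snd (take i ts) @ [- snd (ts ! i)]))"

definition direct_type_tree :: "nat \<Rightarrow> chain set \<Rightarrow> bool" where
  "direct_type_tree n T \<longleftrightarrow> (\<forall>ch\<in>T. cond_star n ch \<and> cond_star_star n T ch)"

definition direct_type_algorithm :: "(nat \<Rightarrow> chain set) \<Rightarrow> bool" where
  "direct_type_algorithm \<T> \<longleftrightarrow> (\<forall>n\<ge>3. direct_type_tree n (\<T> n))"

end

theory Submission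
  imports Defs
begin

text \<open>For \<open>n = 3\<close> there are only two circuits \<open>x\<close> and \<open>y\<close>, so a test is incompatible with \<open>K(y)\<close>
  only if its form is a multiple of \<open>x - y\<close>. On the input
  \<open>c\<^sub>1\<^sub>2 = c\<^sub>2\<^sub>1 = c\<^sub>3\<^sub>2 = 1\<close>, \<open>c\<^sub>1\<^sub>3 = c\<^sub>2\<^sub>3 = c\<^sub>3\<^sub>1 = 0\<close> the algorithm finds \<open>x\<close> first, and after
  the chosen arc \<open>(2, 3)\<close> is forbidden, the lower bound differs from \<open>len(x)\<close> by \<open>c\<^sub>2\<^sub>1 - c\<^sub>2\<^sub>3\<close> only,
  which already stops it. No test on the way compares \<open>x\<close> with \<open>y\<close>; two inputs in \<open>K(y)\<close> witness
  the compatibility of all of them.\<close>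

section \<open>Linear forms and inputs for n = 3\<close>

definition form3 :: "int \<Rightarrow> int \<Rightarrow> int \<Rightarrow> int \<Rightarrow> int \<Rightarrow> int \<Rightarrow> vec" where
  "form3 a b c d e f = (\<lambda>p. if p = (1, 2) then a else if p = (1, 3) then b else
     if p = (2, 1) then c else if p = (2, 3) then d else
     if p = (3, 1) then e else if p = (3, 2) then f else 0)"

text \<open>A comparison of formally identical forms is not counted, so the run must decide equality
  of coefficient vectors. With every form in \<open>form3\<close> shape this is arithmetic on six
  integers.\<close>

lemma form3_eq_iff [simp]:
  "form3 a b c d e f = form3 a' b' c' d' e' f' \<longleftrightarrow>
     a = a' \<and> b = b' \<and> c = c' \<and> d = d' \<and> e = e' \<and> f = f'"
proof
  assume eq: "form3 a b c d e f = form3 a' b' c' d' e' f'"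
  show "a = a' \<and> b = b' \<and> c = c' \<and> d = d' \<and> e = e' \<and> f = f'"
    using fun_cong[OF eq, of "(1, 2)"] fun_cong[OF eq, of "(1, 3)"] fun_cong[OF eq, of "(2, 1)"]
      fun_cong[OF eq, of "(2, 3)"] fun_cong[OF eq, of "(3, 1)"] fun_cong[OF eq, of "(3, 2)"]
    by (simp add: form3_def)
qed simp

lemma form3_arith [simp]:
  "form3 a b c d e f + form3 a' b' c' d' e' f' =
     form3 (a + a') (b + b') (c + c') (d + d') (e + e') (f + f')"
  "form3 a b c d e f - form3 a' b' c' d' e' f' =
     form3 (a - a') (b - b') (c - c') (d - d') (e - e') (f - f')"
  by (auto simp: form3_def)

lemma zero_eq_form3: "(0 :: vec) = form3 0 0 0 0 0 0"
  by (auto simp: form3_def)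

lemma arcs_3: "arcs 3 = {(1, 2), (1, 3), (2, 1), (2, 3), (3, 1), (3, 2)}"
proof -
  have "{1..3} = {1, 2, 3 :: nat}" by auto
  then show ?thesis unfolding arcs_def by auto
qed

lemma inner_prod_form3 [simp]:
  "inner_prod 3 (form3 a b c d e f) (form3 a' b' c' d' e' f') =
     a * a' + b * b' + c * c' + d * d' + e * e' + f * f'"
  by (simp add: inner_prod_def arcs_3 form3_def)

lemma form3_in_inputs [simp]: "form3 a b c d e f \<in> inputs 3"
  by (simp add: inputs_def arcs_3 form3_def)

section \<open>The two circuits and their adjacency\<close>

definition circuit_x :: "(nat \<times> nat) set" where
  "circuit_x = {(1, 2), (2, 3), (3, 1)}"

definition circuit_y :: "(nat \<times> nat) set" where
  "circuit_y = {(1, 3), (2, 1), (3, 2)}"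

lemma char_vec_circuits:
  "char_vec circuit_x = form3 1 0 0 1 1 0" "char_vec circuit_y = form3 0 1 1 0 0 1"
  by (auto simp: char_vec_def circuit_x_def circuit_y_def form3_def)

lemma ham_circuit_3: "ham_circuit 3 H \<longleftrightarrow> H = circuit_x \<or> H = circuit_y"
proof
  assume "ham_circuit 3 H"
  then obtain p where p: "distinct p" "set p = {1..3}" "H = set (zip p (rotate1 p))"
    by (auto simp: ham_circuit_def)
  have "length p = 3"
    using distinct_card[OF p(1)] p(2) by simp
  then obtain a b c where abc: "p = [a, b, c]"
    by (auto simp: numeral_3_eq_3 length_Suc_conv)
  have "{1..3} = {1, 2, 3 :: nat}" by auto
  then have "a \<in> {1, 2, 3}" "b \<in> {1, 2, 3}" "c \<in> {1, 2, 3}" "distinct [a, b, c]"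
    using p(1,2) abc by auto
  then show "H = circuit_x \<or> H = circuit_y"
    unfolding p(3) abc circuit_x_def circuit_y_def by auto
next
  have s: "{1..3} = {1, 2, 3 :: nat}" by auto
  have "ham_circuit 3 circuit_x"
    unfolding ham_circuit_def
    by (rule exI[of _ "[1, 2, 3]"]) (auto simp: circuit_x_def arcs_3 s)
  moreover have "ham_circuit 3 circuit_y"
    unfolding ham_circuit_def
    by (rule exI[of _ "[1, 3, 2]"]) (auto simp: circuit_y_def arcs_3 s)
  moreover assume "H = circuit_x \<or> H = circuit_y"
  ultimately show "ham_circuit 3 H" by blast
qed

lemma solutions_3: "solutions 3 = {form3 1 0 0 1 1 0, form3 0 1 1 0 0 1}"
proof -
  have "solutions 3 = char_vec ` {circuit_x, circuit_y}"
    unfolding solutions_def ham_circuit_3 by blast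
  then show ?thesis by (simp add: char_vec_circuits)
qed

lemma adjacent_3: "adjacent 3 (form3 1 0 0 1 1 0) (form3 0 1 1 0 0 1)"
  unfolding adjacent_def
proof (intro conjI bexI)
  \<comment> \<open>At the zero input every circuit is optimal, and there are only these
    two.\<close>
  show "{z. optimal 3 z (form3 0 0 0 0 0 0)} = {form3 1 0 0 1 1 0, form3 0 1 1 0 0 1}"
    by (auto simp: optimal_def solutions_3)
qed (simp_all add: solutions_3)

text \<open>The two circuits are arc-disjoint, so a single arc determines the circuit. This
  evaluates the definite description met when the algorithm records a solution.\<close>

lemma circuit_containing_3:
  assumes "E \<subseteq> circuit_x" "E \<noteq> {}"
  shows "circuit_containing 3 E = circuit_x"
  unfolding circuit_containing_def
proof (rule the_equality)
  have "circuit_x \<inter> circuit_y = {}"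
    by (simp add: circuit_x_def circuit_y_def)
  then show "H = circuit_x" if "ham_circuit 3 H \<and> E \<subseteq> H" for H
    using that assms by (auto simp: ham_circuit_3)
qed (use assms in \<open>auto simp: ham_circuit_3\<close>)

section \<open>Symbolic reduction of 3 by 3 matrices\<close>

text \<open>Entries outside \<open>{1..3} \<times> {1..3}\<close> are never touched, so they keep their initial values.\<close>

definition mat3 :: "val \<Rightarrow> val \<Rightarrow> val \<Rightarrow> val \<Rightarrow> val \<Rightarrow> val \<Rightarrow> val \<Rightarrow> val \<Rightarrow> val \<Rightarrow> matrix" where
  "mat3 a b c d e f g h k = (\<lambda>i j.
     if i = 1 \<and> j = 1 then a else if i = 1 \<and> j = 2 then b else if i = 1 \<and> j = 3 then c else
     if i = 2 \<and> j = 1 then d else if i = 2 \<and> j = 2 then e else if i = 2 \<and> j = 3 then f else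
     if i = 3 \<and> j = 1 then g else if i = 3 \<and> j = 2 then h else if i = 3 \<and> j = 3 then k else
     init_matrix i j)"

lemma init_matrix_3:
  "init_matrix = mat3 Infty (Fin (form3 1 0 0 0 0 0)) (Fin (form3 0 1 0 0 0 0))
     (Fin (form3 0 0 1 0 0 0)) Infty (Fin (form3 0 0 0 1 0 0))
     (Fin (form3 0 0 0 0 1 0)) (Fin (form3 0 0 0 0 0 1)) Infty"
proof -
  have "char_vec {(1, 2)} = form3 1 0 0 0 0 0" "char_vec {(1, 3)} = form3 0 1 0 0 0 0"
    "char_vec {(2, 1)} = form3 0 0 1 0 0 0" "char_vec {(2, 3)} = form3 0 0 0 1 0 0"
    "char_vec {(3, 1)} = form3 0 0 0 0 1 0" "char_vec {(3, 2)} = form3 0 0 0 0 0 1"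
    by (auto simp: char_vec_def form3_def)
  then show ?thesis
    by (intro ext) (simp add: mat3_def init_matrix_def)
qed

lemma mat3_nth [simp]:
  "mat3 a b c d e f g h k 1 1 = a" "mat3 a b c d e f g h k 1 2 = b"
  "mat3 a b c d e f g h k 1 3 = c" "mat3 a b c d e f g h k 2 1 = d"
  "mat3 a b c d e f g h k 2 2 = e" "mat3 a b c d e f g h k 2 3 = f"
  "mat3 a b c d e f g h k 3 1 = g" "mat3 a b c d e f g h k 3 2 = h"
  "mat3 a b c d e f g h k 3 3 = k"
  by (simp_all add: mat3_def)

lemma mat3_outside:
  "i \<notin> {1, 2, 3} \<or> j \<notin> {1, 2, 3} \<Longrightarrow> mat3 a b c d e f g h k i j = init_matrix i j"
  by (auto simp: mat3_def)

lemma matrix_eqI_3: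
  fixes M N :: matrix
  assumes "M 1 1 = N 1 1" "M 1 2 = N 1 2" "M 1 3 = N 1 3"
    and "M 2 1 = N 2 1" "M 2 2 = N 2 2" "M 2 3 = N 2 3"
    and "M 3 1 = N 3 1" "M 3 2 = N 3 2" "M 3 3 = N 3 3"
    and "\<And>i j. i \<notin> {1, 2, 3} \<or> j \<notin> {1, 2, 3} \<Longrightarrow> M i j = N i j"
  shows "M = N"
proof (intro ext)
  show "M i j = N i j" for i j
    using assms by (cases "i \<in> {1, 2, 3} \<and> j \<in> {1, 2, 3}") (blast, fast)
qed

text \<open>Reduction updates a matrix by a conditional function. Returning to \<open>mat3\<close>
  shape after each update keeps the symbolic run free of nested conditionals.\<close>

lemma mat3_sub_row:
  fixes a b c d e f g h k :: val
  defines "M \<equiv> mat3 a b c d e f g h k"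
  shows
  "(\<lambda>i j. if i = 1 \<and> j \<in> set [1, 2, 3] then sub (M i j) m else M i j) =
     mat3 (sub a m) (sub b m) (sub c m) d e f g h k"
  "(\<lambda>i j. if i = 2 \<and> j \<in> set [1, 2, 3] then sub (M i j) m else M i j) =
     mat3 a b c (sub d m) (sub e m) (sub f m) g h k"
  "(\<lambda>i j. if i = 3 \<and> j \<in> set [1, 2, 3] then sub (M i j) m else M i j) =
     mat3 a b c d e f (sub g m) (sub h m) (sub k m)"
  unfolding M_def by (rule matrix_eqI_3; auto simp: mat3_outside simp del: One_nat_def)+

lemma mat3_sub_col:
  fixes a b c d e f g h k :: val
  defines "M \<equiv> mat3 a b c d e f g h k"
  shows
  "(\<lambda>i j. if j = 1 \<and> i \<in> set [1, 2, 3] then sub (M i j) m else M i j) =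
     mat3 (sub a m) b c (sub d m) e f (sub g m) h k"
  "(\<lambda>i j. if j = 2 \<and> i \<in> set [1, 2, 3] then sub (M i j) m else M i j) =
     mat3 a (sub b m) c d (sub e m) f g (sub h m) k"
  "(\<lambda>i j. if j = 3 \<and> i \<in> set [1, 2, 3] then sub (M i j) m else M i j) =
     mat3 a b (sub c m) d e (sub f m) g h (sub k m)"
  unfolding M_def by (rule matrix_eqI_3; auto simp: mat3_outside simp del: One_nat_def)+

text \<open>These rules replace \<open>reduce_rows.simps(2)\<close> in the symbolic run, where that
  equation is removed from the simplifier.\<close>

lemma reduce_rows_3:
  "reduce_rows n C (1 # I) [1, 2, 3] (mat3 a b c d e f g h k) s =
     (let (t1, m) = scan_min n C Infty [a, b, c];
          (t2, r) = reduce_rows n C I [1, 2, 3] (mat3 (sub a m) (sub b m) (sub c m) d e f g h k) (add s m)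
      in (t1 @ t2, r))"
  "reduce_rows n C (2 # I) [1, 2, 3] (mat3 a b c d e f g h k) s =
     (let (t1, m) = scan_min n C Infty [d, e, f];
          (t2, r) = reduce_rows n C I [1, 2, 3] (mat3 a b c (sub d m) (sub e m) (sub f m) g h k) (add s m)
      in (t1 @ t2, r))"
  "reduce_rows n C (3 # I) [1, 2, 3] (mat3 a b c d e f g h k) s =
     (let (t1, m) = scan_min n C Infty [g, h, k];
          (t2, r) = reduce_rows n C I [1, 2, 3] (mat3 a b c d e f (sub g m) (sub h m) (sub k m)) (add s m)
      in (t1 @ t2, r))"
  by (simp_all only: reduce_rows.simps mat3_sub_row mat3_nth list.map Let_def)

lemma reduce_cols_3:
  "reduce_cols n C [1, 2, 3] (1 # J) (mat3 a b c d e f g h k) s =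
     (let (t1, m) = scan_min n C Infty [a, d, g];
          (t2, r) = reduce_cols n C [1, 2, 3] J (mat3 (sub a m) b c (sub d m) e f (sub g m) h k) (add s m)
      in (t1 @ t2, r))"
  "reduce_cols n C [1, 2, 3] (2 # J) (mat3 a b c d e f g h k) s =
     (let (t1, m) = scan_min n C Infty [b, e, h];
          (t2, r) = reduce_cols n C [1, 2, 3] J (mat3 a (sub b m) c d (sub e m) f g (sub h m) k) (add s m)
      in (t1 @ t2, r))"
  "reduce_cols n C [1, 2, 3] (3 # J) (mat3 a b c d e f g h k) s =
     (let (t1, m) = scan_min n C Infty [c, f, k];
          (t2, r) = reduce_cols n C [1, 2, 3] J (mat3 a b (sub c m) d e (sub f m) g h (sub k m)) (add s m)
      in (t1 @ t2, r))"
  by (simp_all only: reduce_cols.simps mat3_sub_col mat3_nth list.map Let_def)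

lemma upd_mat3_23:
  "upd (mat3 a b c d e f g h k) 2 3 v = mat3 a b c d e v g h k"
  by (rule matrix_eqI_3) (auto simp: upd_def mat3_outside simp del: One_nat_def)

section \<open>The run on the chosen input\<close>

context
  notes One_nat_def [simp del] reduce_rows.simps(2) [simp del] reduce_cols.simps(2) [simp del]
    zero_eq_form3 [simp] strict_test_def [simp] nonstrict_test_def [simp]
begin

lemma branch_bound_root:
  "branch_bound 3 (form3 1 0 1 0 0 1) [1, 2, 3] [1, 2, 3] init_matrix {} (Fin 0) {} Infty =
    ([(form3 1 (-1) 0 0 0 0, 1), (form3 0 0 1 (-1) 0 0, 1), (form3 0 0 0 0 1 (-1), -1),
      (form3 0 0 1 (-1) 0 0, 1), (form3 1 (-1) 0 0 1 (-1), -1), (form3 1 (-1) 0 0 1 (-1), -1),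
      (form3 0 0 1 (-1) 0 0, 1), (form3 1 (-1) 1 (-1) 1 (-1), 1),
      (form3 (-1) 1 0 0 (-1) 1, -1), (form3 (-1) 1 0 0 (-1) 1, -1),
      (form3 0 0 (-1) 1 0 0, -1), (form3 1 (-1) 0 0 1 (-1), -1),
      (form3 1 (-1) 0 0 1 (-1), -1), (form3 0 0 1 (-1) 0 0, 1)],
     circuit_x, Fin (form3 1 0 0 1 1 0))"
proof -
  let ?C = "form3 1 0 1 0 0 1" and ?N = "[1, 2, 3] :: nat list"
  \<comment> \<open>\<open>?M1\<close> is the reduced root matrix, \<open>?M2\<close> the same with
    (2, 3) forbidden. Entry (3, 2) is c13 + c32 - c12 - c31, which vanishes on \<open>?C\<close> but
    not formally, so tests on it are counted.\<close>
  let ?M1 = "mat3 Infty (Fin 0) (Fin 0) (Fin (form3 0 0 1 (-1) 0 0)) Infty (Fin 0)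
    (Fin 0) (Fin (form3 (-1) 1 0 0 (-1) 1)) Infty"
  let ?M2 = "mat3 Infty (Fin 0) (Fin 0) (Fin (form3 0 0 1 (-1) 0 0)) Infty Infty
    (Fin 0) (Fin (form3 (-1) 1 0 0 (-1) 1)) Infty"
  \<comment> \<open>The row minima c13, c23, c31 and the minimum c12 - c13 of column 2 add up to
    len(x): the bound is the form of x before any arc is chosen.\<close>
  have reduction: "reduction 3 ?C ?N ?N init_matrix (Fin 0) =
    ([(form3 1 (-1) 0 0 0 0, 1), (form3 0 0 1 (-1) 0 0, 1), (form3 0 0 0 0 1 (-1), -1),
      (form3 0 0 1 (-1) 0 0, 1), (form3 1 (-1) 0 0 1 (-1), -1)],
     ?M1, Fin (form3 1 0 0 1 1 0))"
    by (simp add: reduction_def init_matrix_3 reduce_rows_3 reduce_cols_3)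
  \<comment> \<open>Arc (2, 3) has weight c21 - c23. Arc (3, 1) ties with it on \<open>?C\<close>,
    and the strict comparison keeps the earlier arc.\<close>
  have choose_arc: "choose_arc 3 ?C ?N ?N ?M1 =
    ([(form3 1 (-1) 0 0 1 (-1), -1), (form3 0 0 1 (-1) 0 0, 1),
      (form3 1 (-1) 1 (-1) 1 (-1), 1), (form3 (-1) 1 0 0 (-1) 1, -1),
      (form3 (-1) 1 0 0 (-1) 1, -1), (form3 0 0 (-1) 1 0 0, -1)], Some (2, 3))"
    by (simp add: choose_arc_def)
  \<comment> \<open>Row 2 has one finite entry left, c21 - c23, which is added to the bound without
    a counted test. The last test compares the new bound with len(x) and stops the branch.\<close>
  have cut: "branch_bound 3 ?C ?N ?N ?M2 {} (Fin (form3 1 0 0 1 1 0)) circuit_x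
      (Fin (form3 1 0 0 1 1 0)) =
    ([(form3 1 (-1) 0 0 1 (-1), -1), (form3 1 (-1) 0 0 1 (-1), -1),
      (form3 0 0 1 (-1) 0 0, 1)], circuit_x, Fin (form3 1 0 0 1 1 0))"
    by (subst branch_bound.simps) (simp add: reduction_def reduce_rows_3 reduce_cols_3)
  have "circuit_containing 3 {(2, 3)} = circuit_x"
    by (rule circuit_containing_3) (auto simp: circuit_x_def)
  \<comment> \<open>Recording x costs no counted test, because \<open>lopt\<close> is still
    infinite. \<open>zero_eq_form3\<close> is switched off so that \<open>Fin 0\<close> still
    matches the facts above.\<close>
  then show ?thesis
    by (subst branch_bound.simps)
      (simp add: reduction choose_arc cut upd_mat3_23 char_vec_circuits del: zero_eq_form3)
qed

end

theorem mainTheorem2: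
  shows "\<not> direct_type_algorithm sep_tree \<and>
    (\<exists>n\<ge>3. \<exists>ts x y. (ts, x) \<in> sep_tree n \<and> y \<in> solutions n \<and> adjacent n x y \<and>
       (\<forall>i<length ts. \<exists>C\<in>inputs n.
          inner_prod n (fst (ts ! i)) C * snd (ts ! i) > 0 \<and> C \<in> K n y))"
proof -
  let ?x = "form3 1 0 0 1 1 0" and ?y = "form3 0 1 1 0 0 1"
  obtain ts where run: "run 3 (form3 1 0 1 0 0 1) = (ts, ?x)"
    and ts: "set ts \<subseteq> {(form3 1 (-1) 0 0 0 0, 1), (form3 0 0 1 (-1) 0 0, 1),
      (form3 0 0 0 0 1 (-1), -1), (form3 1 (-1) 0 0 1 (-1), -1),
      (form3 1 (-1) 1 (-1) 1 (-1), 1), (form3 (-1) 1 0 0 (-1) 1, -1),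
      (form3 0 0 (-1) 1 0 0, -1)}"
  proof -
    have "[1..<3 + 1] = [1, 2, 3 :: nat]"
      by (simp add: upt_rec)
    with branch_bound_root that show thesis
      by (simp add: run_def char_vec_circuits del: One_nat_def)
  qed
  \<comment> \<open>At both witnesses x and y have equal length. The chain contains a form and its
    negative, both with outcome -1, so no single input can satisfy all tests strictly. The first
    witness serves every test except (\<open>form3 1 (-1) 0 0 1 (-1)\<close>, -1), which the second
    one serves.\<close>
  have "form3 2 0 1 0 0 1 \<in> K 3 ?y" "form3 0 1 0 1 0 0 \<in> K 3 ?y"
    by (simp_all add: K_def solutions_3)
  moreover have "inner_prod 3 (fst t) (form3 2 0 1 0 0 1) * snd t > 0 \<or>
      inner_prod 3 (fst t) (form3 0 1 0 1 0 0) * snd t > 0" if "t \<in> set ts" for t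
    using that ts by auto
  ultimately have compatible:
    "\<exists>C\<in>inputs 3. inner_prod 3 (fst (ts ! i)) C * snd (ts ! i) > 0 \<and> C \<in> K 3 ?y"
    if "i < length ts" for i
    using nth_mem[OF that] form3_in_inputs by metis
  have chain: "(ts, ?x) \<in> sep_tree 3"
    unfolding sep_tree_def using run by (metis form3_in_inputs imageI)
  have y: "?y \<in> solutions 3"
    by (simp add: solutions_3)
  have "\<not> cond_star 3 (ts, ?x)"
    unfolding cond_star_def incompatible_def using y adjacent_3 compatible by blast
  then have "\<not> direct_type_algorithm sep_tree"
    unfolding direct_type_algorithm_def direct_type_tree_def using chain by blast
  then show ?thesis
    using chain y adjacent_3 compatible by blast
qed

end
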